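(* Let $m\ge 2$, $n\ge 1$ and let $\mathcal{B}=(b_{i_1\cdots i_m})\in T_{m,n}$ be a Z tensor. Then the following three properties are equivalent: (i) $\mathcal{B}$ is a B tensor; (ii) for each $i\in I_n$, $\sum_{i_2,\dots,i_m=1}^n b_{ii_2\cdots i_m}>0$; (iii) $\mathcal{B}$ is strictly diagonally dominated. Likewise, the following three properties are equivalent: (i$_0$) $\mathcal{B}$ is a B$_0$ tensor; (ii$_0$) for each $i\in I_n$, $\sum_{i_2,\dots,i_m=1}^n b_{ii_2\cdots i_m}\ge 0$; (iii$_0$) $\mathcal{B}$ is diagonally dominated.
   Context: $I_n=\{1,\dots,n\}$. $T_{m,n}$ is the set of real $m$th order $n$-dimensional tensors $\mathcal{B}=(b_{i_1\cdots i_m})$, $i_1,\dots,i_m\in I_n$. $\mathcal{B}$ is a Z tensor if all its off-diagonal entries are non-positive, i.e. $b_{i_1\cdots i_m}\le 0$ whenever $i_1,\dots,i_m$ are not all equal. $\mathcal{B}$ is diagonally dominated if for all $i\in I_n$, $b_{i\cdots i}\ge\sum\{|b_{ii_2\cdots i_m}|:(i_2,\dots,i_m)\ne(i,\dots,i),\ i_2,\dots,i_m\in I_n\}$, and strictly diagonally dominated if this holds with "$>$" for all $i\in I_n$. $\mathcal{B}$ is a B tensor if for all $i\in I_n$: $\sum_{i_2,\dots,i_m=1}^n b_{ii_2\cdots i_m}>0$ and $\frac{1}{n^{m-1}}\sum_{i_2,\dots,i_m=1}^n b_{ii_2\cdots i_m}>b_{ij_2\cdots j_m}$ for all $(j_2,\dots,j_m)\ne(i,\dots,i)$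 with $j_2,\dots,j_m\in I_n$. $\mathcal{B}$ is a B$_0$ tensor if the same conditions hold with both "$>$" replaced by "$\ge$". *)

theory Defs
  imports Complex_Main "HOL-Library.FuncSet"
begin

text \<open>
  A multi-index \<open>(i\<^sub>1, \<dots>, i\<^sub>k)\<close> with entries in \<open>I\<^sub>n = {1, \<dots>, n}\<close> is a list of length
  \<open>k\<close>. The entry \<open>b\<close> with first index \<open>i\<close> and remaining indices \<open>js\<close> is \<open>B (i # js)\<close>, and the
  constant tuple \<open>(i, \<dots>, i)\<close> of length \<open>k\<close> is \<open>replicate k i\<close>.
\<close>

definition multi_indices :: "nat \<Rightarrow> nat \<Rightarrow> nat list set" where
  "multi_indices n k = {ks. set ks \<subseteq> {1..n} \<and> length ks = k}"

lemma finite_multi_indices [simp]: "finite (multi_indices n k)"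
  unfolding multi_indices_def by (rule finite_lists_length_eq) simp

text \<open>\<open>T\<^bsub>m,n\<^esub>\<close>; the value outside the index set is fixed to be \<open>undefined\<close>.\<close>

definition tensors :: "nat \<Rightarrow> nat \<Rightarrow> (nat list \<Rightarrow> real) set" where
  "tensors m n = multi_indices n m \<rightarrow>\<^sub>E (UNIV :: real set)"

definition row_sum :: "nat \<Rightarrow> nat \<Rightarrow> (nat list \<Rightarrow> real) \<Rightarrow> nat \<Rightarrow> real" where
  "row_sum m n B i = (\<Sum>js \<in> multi_indices n (m - 1). B (i # js))"

definition Z_tensor :: "nat \<Rightarrow> nat \<Rightarrow> (nat list \<Rightarrow> real) \<Rightarrow> bool" where
  "Z_tensor m n B \<longleftrightarrow>
    (\<forall>ks \<in> multi_indices n m. \<not> (\<forall>j \<in> set ks. \<forall>k \<in> set ks. j = k) \<longrightarrow> B ks \<le> 0)"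

definition diagonally_dominated :: "nat \<Rightarrow> nat \<Rightarrow> (nat list \<Rightarrow> real) \<Rightarrow> bool" where
  "diagonally_dominated m n B \<longleftrightarrow>
    (\<forall>i \<in> {1..n}. B (replicate m i) \<ge>
      (\<Sum>js \<in> multi_indices n (m - 1) - {replicate (m - 1) i}. \<bar>B (i # js)\<bar>))"

definition strictly_diagonally_dominated :: "nat \<Rightarrow> nat \<Rightarrow> (nat list \<Rightarrow> real) \<Rightarrow> bool" where
  "strictly_diagonally_dominated m n B \<longleftrightarrow>
    (\<forall>i \<in> {1..n}. B (replicate m i) >
      (\<Sum>js \<in> multi_indices n (m - 1) - {replicate (m - 1) i}. \<bar>B (i # js)\<bar>))"

definition B_tensor :: "nat \<Rightarrow> nat \<Rightarrow> (nat list \<Rightarrow> real) \<Rightarrow> bool" where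
  "B_tensor m n B \<longleftrightarrow>
    (\<forall>i \<in> {1..n}. row_sum m n B i > 0 \<and>
      (\<forall>js \<in> multi_indices n (m - 1). js \<noteq> replicate (m - 1) i \<longrightarrow>
        1 / real n ^ (m - 1) * row_sum m n B i > B (i # js)))"

definition B0_tensor :: "nat \<Rightarrow> nat \<Rightarrow> (nat list \<Rightarrow> real) \<Rightarrow> bool" where
  "B0_tensor m n B \<longleftrightarrow>
    (\<forall>i \<in> {1..n}. row_sum m n B i \<ge> 0 \<and>
      (\<forall>js \<in> multi_indices n (m - 1). js \<noteq> replicate (m - 1) i \<longrightarrow>
        1 / real n ^ (m - 1) * row_sum m n B i \<ge> B (i # js)))"

end

theory Submission
  imports Defs
begin

text \<open>Everything reduces to the sign of the row sums. Off-diagonal entries of a Z tensor are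
  non-positive, so each is minus its absolute value, and a row sum is exactly the diagonal entry
  minus the sum that dominance compares it with (\<open>Z_tensor_row_sum\<close>). Hence positive
  row sums amount to strict dominance, non-negative ones to dominance. The B condition contains
  positivity of the row sums; conversely, a positive row sum has a positive mean, which exceeds
  every off-diagonal entry because these are at most 0
  (\<open>Z_tensor_off_diagonal_nonpos\<close>). The B0 case is the same with weak
  inequalities.\<close>

lemma Z_tensor_off_diagonal_nonpos:
  assumes "Z_tensor m n B" and "m \<ge> 1" and "i \<in> {1..n}"
    and js: "js \<in> multi_indices n (m - 1)" "js \<noteq> replicate (m - 1) i"
  shows "B (i # js) \<le> 0"
proof -
  have "i # js \<in> multi_indices n m"
    using assms by (auto simp: multi_indices_def)
  \<comment> \<open>A list of length \<open>m - 1\<close> with all entries equal to \<open>i\<close>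
    would be the excluded \<open>replicate (m - 1) i\<close>. The entry found here, together with
    the head \<open>i\<close>, shows that \<open>i # js\<close> is not constant.\<close>
  moreover have "\<exists>j \<in> set js. j \<noteq> i"
    using js by (metis (mono_tags, lifting) mem_Collect_eq multi_indices_def replicate_eqI)
  ultimately show ?thesis
    using \<open>Z_tensor m n B\<close> unfolding Z_tensor_def by (metis list.set_intros)
qed

text \<open>Splitting off the diagonal term leaves only non-positive terms, whose absolute values
  are their negatives. This identity turns both dominance conditions into sign conditions on
  \<open>row_sum\<close>.\<close>

lemma Z_tensor_row_sum:
  assumes "Z_tensor m n B" and "m \<ge> 1" and "i \<in> {1..n}"
  shows "row_sum m n B i = B (replicate m i) -
    (\<Sum>js \<in> multi_indices n (m - 1) - {replicate (m - 1) i}. \<bar>B (i # js)\<bar>)"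
proof -
  let ?r = "replicate (m - 1) i" and ?M = "multi_indices n (m - 1)"
  have "?r \<in> ?M"
    using \<open>i \<in> {1..n}\<close> by (auto simp: multi_indices_def)
  then have "row_sum m n B i = B (i # ?r) + (\<Sum>js \<in> ?M - {?r}. B (i # js))"
    unfolding row_sum_def by (simp add: sum.remove)
  also have "i # ?r = replicate m i"
    using \<open>m \<ge> 1\<close> by (simp flip: replicate_Suc)
  also have "(\<Sum>js \<in> ?M - {?r}. B (i # js)) = - (\<Sum>js \<in> ?M - {?r}. \<bar>B (i # js)\<bar>)"
    unfolding sum_negf [symmetric]
    using Z_tensor_off_diagonal_nonpos [OF assms] by (intro sum.cong) auto
  finally show ?thesis by simp
qed

theorem theorem5p5:
  fixes m n :: nat and B :: "nat list \<Rightarrow> real"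
  assumes "m \<ge> 2" and "n \<ge> 1"
    and "B \<in> tensors m n"
    and "Z_tensor m n B"
  shows "((B_tensor m n B \<longleftrightarrow> (\<forall>i \<in> {1..n}. row_sum m n B i > 0)) \<and>
          ((\<forall>i \<in> {1..n}. row_sum m n B i > 0) \<longleftrightarrow> strictly_diagonally_dominated m n B)) \<and>
         ((B0_tensor m n B \<longleftrightarrow> (\<forall>i \<in> {1..n}. row_sum m n B i \<ge> 0)) \<and>
          ((\<forall>i \<in> {1..n}. row_sum m n B i \<ge> 0) \<longleftrightarrow> diagonally_dominated m n B))"
proof -
  have row: "row_sum m n B i = B (replicate m i) -
      (\<Sum>js \<in> multi_indices n (m - 1) - {replicate (m - 1) i}. \<bar>B (i # js)\<bar>)"
    if "i \<in> {1..n}" for i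
    using Z_tensor_row_sum that assms by simp
  have off: "B (i # js) \<le> 0"
    if "i \<in> {1..n}" "js \<in> multi_indices n (m - 1)" "js \<noteq> replicate (m - 1) i" for i js
    using Z_tensor_off_diagonal_nonpos that assms by simp
  have "B_tensor m n B \<longleftrightarrow> (\<forall>i \<in> {1..n}. row_sum m n B i > 0)"
  proof
    assume pos: "\<forall>i \<in> {1..n}. row_sum m n B i > 0"
    have "B (i # js) < 1 / real n ^ (m - 1) * row_sum m n B i"
      if "i \<in> {1..n}" "js \<in> multi_indices n (m - 1)" "js \<noteq> replicate (m - 1) i" for i js
    proof -
      \<comment> \<open>The strictness must come from the mean, since the off-diagonal entry may be
        0; \<open>n \<ge> 1\<close> makes the factor positive.\<close>
      have "0 < 1 / real n ^ (m - 1) * row_sum m n B i"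
        using pos that \<open>n \<ge> 1\<close> by (intro mult_pos_pos) auto
      with off [OF that] show ?thesis by linarith
    qed
    with pos show "B_tensor m n B" by (simp add: B_tensor_def)
  qed (simp add: B_tensor_def)
  moreover have "B0_tensor m n B \<longleftrightarrow> (\<forall>i \<in> {1..n}. row_sum m n B i \<ge> 0)"
  proof
    assume nonneg: "\<forall>i \<in> {1..n}. row_sum m n B i \<ge> 0"
    have "B (i # js) \<le> 1 / real n ^ (m - 1) * row_sum m n B i"
      if "i \<in> {1..n}" "js \<in> multi_indices n (m - 1)" "js \<noteq> replicate (m - 1) i" for i js
    proof -
      have "0 \<le> 1 / real n ^ (m - 1) * row_sum m n B i"
        using nonneg that by (intro mult_nonneg_nonneg) auto
      with off [OF that] show ?thesis by linarith
    qed
    with nonneg show "B0_tensor m n B" by (simp add: B0_tensor_def)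
  qed (simp add: B0_tensor_def)
  moreover have "(\<forall>i \<in> {1..n}. row_sum m n B i > 0) \<longleftrightarrow> strictly_diagonally_dominated m n B"
    \<comment> \<open>After rewriting with \<open>row\<close>, the two sides differ only by moving
      the sum of absolute values across the inequality.\<close>
    unfolding strictly_diagonally_dominated_def by (intro ball_cong) (simp_all add: row)
  moreover have "(\<forall>i \<in> {1..n}. row_sum m n B i \<ge> 0) \<longleftrightarrow> diagonally_dominated m n B"
    unfolding diagonally_dominated_def by (intro ball_cong) (simp_all add: row)
  ultimately show ?thesis by blast
qed

end
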